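(* Let $R$ be a commutative ring with $1$, let $\mathfrak G$ be the matroid of a hyperplane arrangement on $[n]$, of rank two, with $n\ge 3$, and let $\lambda\in R^n$. If $\lambda_{[n]}$ is a zero divisor with $\operatorname{Ann}_R(\lambda_{[n]})\ne\operatorname{Ann}_R(\lambda)$, then $\lambda$ is resonant, i.e. $\lambda\in\mathcal R^1(\mathfrak G,R)$.
   Context: Let $\mathcal A=\{H_1,\dots,H_n\}$ be an arrangement of distinct linear hyperplanes in $\mathbb C^\ell$ and $\mathfrak G$ its matroid on $[n]$: circuits are the minimal $C\subseteq[n]$ with $\operatorname{codim}\bigcap_{i\in C}H_i<|C|$; the rank is $\operatorname{codim}\bigcap_iH_i$. The Orlik–Solomon algebra $A_R(\mathfrak G)$ is the quotient of the exterior algebra over $R$ on $e_1,\dots,e_n$ by the ideal generated by $\partial e_C=\sum_{k=1}^p(-1)^{k-1}e_{i_1}\wedge\cdots\widehat{e_{i_k}}\cdots\wedge e_{i_p}$ for circuits $C=\{i_1<\dots<i_p\}$; $a_i$ is the image of $e_i$, $a_\xi=\sum_i\xi_ia_i$. Vectors $\lambda,\eta$ are parallel if all $\lambda_i\eta_j-\lambda_j\eta_i=0$. $\lambda$ is resonant if there is $\eta\in R^n$, not parallel to $\lambda$, with $a_\lambda\wedge a_\eta=0$; $\mathcal R^1(\mathfrak G,R)$ is the set of resonant $\lambda$. Convention: $s\in R$ is a zero divisor if $\operatorname{Ann}_R(s)=\{r: rs=0\}\neq 0$. $\operatorname{Ann}_R(\lambda)=\{r\in R: r\lambda=0\}$ and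 $\lambda_{[n]}=\sum_i\lambda_i$. *)

theory Defs
  imports "HOL-Analysis.Analysis" "HOL-Algebra.QuotRing"
begin

definition codim :: "(complex ^ 'l) set \<Rightarrow> nat" where
  "codim U = CARD('l) - vec.dim U"

definition linear_hyperplane :: "(complex ^ 'l) set \<Rightarrow> bool" where
  "linear_hyperplane U \<longleftrightarrow> vec.subspace U \<and> codim U = 1"

definition hyperplane_arrangement :: "nat \<Rightarrow> (nat \<Rightarrow> (complex ^ 'l) set) \<Rightarrow> bool" where
  "hyperplane_arrangement n H \<longleftrightarrow>
     (\<forall>i\<in>{1..n}. linear_hyperplane (H i)) \<and> inj_on H {1..n}"

definition dependent_set :: "(nat \<Rightarrow> (complex ^ 'l) set) \<Rightarrow> nat set \<Rightarrow> bool" where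
  "dependent_set H C \<longleftrightarrow> codim (\<Inter>i\<in>C. H i) < card C"

text \<open>A matroid on \<open>{1..n}\<close> is represented by its set of circuits.\<close>

definition arr_matroid :: "nat \<Rightarrow> (nat \<Rightarrow> (complex ^ 'l) set) \<Rightarrow> nat set set" where
  "arr_matroid n H =
     {C. C \<subseteq> {1..n} \<and> dependent_set H C \<and> (\<forall>D. D \<subset> C \<longrightarrow> \<not> dependent_set H D)}"

definition arr_rank :: "nat \<Rightarrow> (nat \<Rightarrow> (complex ^ 'l) set) \<Rightarrow> nat" where
  "arr_rank n H = codim (\<Inter>i\<in>{1..n}. H i)"

text \<open>
  An element of the exterior algebra on \<open>e\<^sub>1, \<dots>, e\<^sub>n\<close> is the family of its coefficients in the basis
  \<open>e\<^sub>S = e\<^sub>i\<^sub>1 \<and> \<dots> \<and> e\<^sub>i\<^sub>p\<close>, where \<open>S = {i\<^sub>1 < \<dots> < i\<^sub>p}\<close> ranges over the subsets of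
  \<open>{1..n}\<close>.  For disjoint \<open>S\<close> and \<open>T\<close> one has \<open>e\<^sub>S \<and> e\<^sub>T = ext_sign S T * e\<^sub>S\<^sub>\<union>\<^sub>T\<close>, and otherwise
  \<open>e\<^sub>S \<and> e\<^sub>T = 0\<close>.
\<close>

definition ext_sign :: "nat set \<Rightarrow> nat set \<Rightarrow> 'a::comm_ring_1" where
  "ext_sign S T = (- 1) ^ card {(s, t). s \<in> S \<and> t \<in> T \<and> t < s}"

definition ext_mult :: "(nat set \<Rightarrow> 'a::comm_ring_1) \<Rightarrow> (nat set \<Rightarrow> 'a) \<Rightarrow> nat set \<Rightarrow> 'a" where
  "ext_mult f g = (\<lambda>U. \<Sum>S\<in>Pow U. ext_sign S (U - S) * f S * g (U - S))"

definition ext_basis :: "nat set \<Rightarrow> nat set \<Rightarrow> 'a::comm_ring_1" where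
  "ext_basis S = (\<lambda>U. if U = S then 1 else 0)"

definition ext_scalar :: "'a::comm_ring_1 \<Rightarrow> nat set \<Rightarrow> 'a" where
  "ext_scalar r = (\<lambda>U. if U = {} then r else 0)"

definition ext_alg :: "nat \<Rightarrow> (nat set \<Rightarrow> 'a::comm_ring_1) ring" where
  "ext_alg n =
     \<lparr>carrier = {f. \<forall>S. \<not> S \<subseteq> {1..n} \<longrightarrow> f S = 0},
      mult = ext_mult,
      one = ext_scalar 1,
      zero = (\<lambda>_. 0),
      add = (\<lambda>f g S. f S + g S)\<rparr>"

definition ext_gen :: "nat \<Rightarrow> nat set \<Rightarrow> 'a::comm_ring_1" where
  "ext_gen i = ext_basis {i}"

definition ext_wedge :: "nat \<Rightarrow> nat list \<Rightarrow> nat set \<Rightarrow> 'a::comm_ring_1" where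
  "ext_wedge n xs = foldr (\<lambda>i x. ext_gen i \<otimes>\<^bsub>ext_alg n\<^esub> x) xs \<one>\<^bsub>ext_alg n\<^esub>"

text \<open>
  \<open>\<partial> e\<^sub>C\<close>: the index \<open>k\<close> counts from \<open>0\<close>, and \<open>take k xs @ drop (Suc k) xs\<close> omits \<open>xs ! k\<close>.
\<close>

definition ext_boundary :: "nat \<Rightarrow> nat set \<Rightarrow> nat set \<Rightarrow> 'a::comm_ring_1" where
  "ext_boundary n C =
     (let xs = sorted_list_of_set C in
      \<Oplus>\<^bsub>ext_alg n\<^esub>k\<in>{..<length xs}.
        ext_scalar ((- 1) ^ k) \<otimes>\<^bsub>ext_alg n\<^esub> ext_wedge n (take k xs @ drop (Suc k) xs))"

lemma ext_sign_Un1: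
  assumes "finite S" "finite T" "finite V" "S \<inter> T = {}"
  shows "(ext_sign (S \<union> T) V :: 'a::comm_ring_1) = ext_sign S V * ext_sign T V"
proof -
  have *: "{(s, t). s \<in> S \<union> T \<and> t \<in> V \<and> t < s} =
        {(s, t). s \<in> S \<and> t \<in> V \<and> t < s} \<union> {(s, t). s \<in> T \<and> t \<in> V \<and> t < s}"
    by auto
  have "finite {(s, t). s \<in> S \<and> t \<in> V \<and> t < s}" "finite {(s, t). s \<in> T \<and> t \<in> V \<and> t < s}"
    by (rule finite_subset[of _ "S \<times> V"] finite_subset[of _ "T \<times> V"]; use assms in auto)+
  moreover have "{(s, t). s \<in> S \<and> t \<in> V \<and> t < s} \<inter> {(s, t). s \<in> T \<and> t \<in> V \<and> t < s} = {}"
    using assms by auto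
  ultimately show ?thesis
    unfolding ext_sign_def * by (simp add: card_Un_disjoint power_add)
qed

lemma ext_sign_Un2:
  assumes "finite S" "finite T" "finite V" "T \<inter> V = {}"
  shows "(ext_sign S (T \<union> V) :: 'a::comm_ring_1) = ext_sign S T * ext_sign S V"
proof -
  have *: "{(s, t). s \<in> S \<and> t \<in> T \<union> V \<and> t < s} =
        {(s, t). s \<in> S \<and> t \<in> T \<and> t < s} \<union> {(s, t). s \<in> S \<and> t \<in> V \<and> t < s}"
    by auto
  have "finite {(s, t). s \<in> S \<and> t \<in> T \<and> t < s}" "finite {(s, t). s \<in> S \<and> t \<in> V \<and> t < s}"
    by (rule finite_subset[of _ "S \<times> T"] finite_subset[of _ "S \<times> V"]; use assms in auto)+
  moreover have "{(s, t). s \<in> S \<and> t \<in> T \<and> t < s} \<inter> {(s, t). s \<in> S \<and> t \<in> V \<and> t < s} = {}"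
    using assms by auto
  ultimately show ?thesis
    unfolding ext_sign_def * by (simp add: card_Un_disjoint power_add)
qed

lemma ext_sign_empty [simp]: "ext_sign {} S = 1" "ext_sign S {} = 1"
  by (simp_all add: ext_sign_def)

lemma ext_mult_infinite: "infinite U \<Longrightarrow> ext_mult f g U = 0"
  by (simp add: ext_mult_def)

lemma ext_mult_assoc:
  "ext_mult (ext_mult f g) h = ext_mult f (ext_mult g h)"
proof
  fix U :: "nat set"
  show "ext_mult (ext_mult f g) h U = ext_mult f (ext_mult g h) U"
  proof (cases "finite U")
    case False
    then show ?thesis by (simp add: ext_mult_infinite)
  next
    case True
    have "ext_mult (ext_mult f g) h U =
        (\<Sum>S\<in>Pow U. \<Sum>T\<in>Pow S. ext_sign S (U - S) * ext_sign T (S - T) * f T * g (S - T) * h (U - S))"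
      by (simp add: ext_mult_def sum_distrib_left sum_distrib_right mult_ac)
    also have "\<dots> = (\<Sum>(S, T)\<in>(SIGMA S:Pow U. Pow S).
        ext_sign S (U - S) * ext_sign T (S - T) * f T * g (S - T) * h (U - S))"
      using True by (subst sum.Sigma) (auto intro: finite_subset)
    also have "\<dots> = (\<Sum>(T, V)\<in>(SIGMA T:Pow U. Pow (U - T)).
        ext_sign T (U - T) * ext_sign V (U - T - V) * f T * g V * h (U - T - V))"
    proof (rule sum.reindex_bij_witness[where i = "\<lambda>(T, V). (T \<union> V, T)" and j = "\<lambda>(S, T). (T, S - T)"])
      fix a assume "a \<in> (SIGMA S:Pow U. Pow S)"
      then obtain S T where a: "a = (S, T)" and ST: "S \<subseteq> U" "T \<subseteq> S" by auto
      have fin: "finite S" "finite T" using ST True by (auto intro: finite_subset)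
      have 1: "ext_sign S (U - S) = (ext_sign T (U - S) * ext_sign (S - T) (U - S) :: 'a)"
        using ext_sign_Un1[of T "S - T" "U - S"] fin True ST by (simp add: Un_absorb1)
      have "U - T = (S - T) \<union> (U - S)" using ST by auto
      then have 2: "ext_sign T (U - T) = (ext_sign T (S - T) * ext_sign T (U - S) :: 'a)"
        using ext_sign_Un2[of T "S - T" "U - S"] fin True by auto
      have "U - T - (S - T) = U - S" using ST by auto
      then show "(case (case a of (S, T) \<Rightarrow> (T, S - T)) of
          (T, V) \<Rightarrow> ext_sign T (U - T) * ext_sign V (U - T - V) * f T * g V * h (U - T - V)) =
          (case a of (S, T) \<Rightarrow> ext_sign S (U - S) * ext_sign T (S - T) * f T * g (S - T) * h (U - S))"
        using 1 2 by (simp add: a mult_ac)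
    qed auto
    also have "\<dots> = (\<Sum>T\<in>Pow U. \<Sum>V\<in>Pow (U - T).
        ext_sign T (U - T) * ext_sign V (U - T - V) * f T * g V * h (U - T - V))"
      using True by (subst sum.Sigma) (auto intro: finite_subset)
    also have "\<dots> = ext_mult f (ext_mult g h) U"
      by (simp add: ext_mult_def sum_distrib_left mult_ac)
    finally show ?thesis .
  qed
qed

lemma ext_mult_scalar_left:
  assumes "finite U"
  shows "ext_mult (ext_scalar r) f U = r * f U"
proof -
  have "ext_mult (ext_scalar r) f U =
      (\<Sum>S\<in>Pow U. if S = {} then r * f U else 0)"
    unfolding ext_mult_def ext_scalar_def by (rule sum.cong) auto
  then show ?thesis using assms by simp
qed

lemma ext_mult_scalar_right:
  assumes "finite U"
  shows "ext_mult f (ext_scalar r) U = r * f U"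
proof -
  have "ext_mult f (ext_scalar r) U = (\<Sum>S\<in>Pow U. if S = U then r * f U else 0)"
    unfolding ext_mult_def ext_scalar_def by (rule sum.cong) (auto simp: mult_ac)
  then show ?thesis using assms by simp
qed

lemma ext_mult_basis:
  assumes "finite S" "finite T"
  shows "ext_mult (ext_basis S) (ext_basis T) =
    (\<lambda>U. if S \<inter> T = {} \<and> U = S \<union> T then ext_sign S T else (0 :: 'a::comm_ring_1))"
proof
  fix U :: "nat set"
  show "ext_mult (ext_basis S) (ext_basis T) U =
      (if S \<inter> T = {} \<and> U = S \<union> T then ext_sign S T else (0 :: 'a))"
  proof (cases "finite U")
    case False
    then show ?thesis using assms by (auto simp: ext_mult_infinite)
  next
    case True
    have "ext_mult (ext_basis S) (ext_basis T) U =
        (\<Sum>X\<in>Pow U. if X = S then (if U - S = T then ext_sign S T else 0) else (0 :: 'a))"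
      unfolding ext_mult_def ext_basis_def by (rule sum.cong) auto
    also have "\<dots> = (if S \<subseteq> U \<and> U - S = T then ext_sign S T else 0)"
      using True by simp
    finally show ?thesis by auto
  qed
qed

lemma ext_gen_square: "ext_mult (ext_gen i) (ext_gen i) = (\<lambda>_. 0)"
  by (simp add: ext_gen_def ext_mult_basis)

lemma ext_gen_anticommute:
  "ext_mult (ext_gen i) (ext_gen j) = (\<lambda>U. - ext_mult (ext_gen j) (ext_gen i) U)"
proof (cases "i = j")
  case False
  have *: "{(s, t). s = a \<and> t = b \<and> t < s} = (if b < a then {(a, b)} else {})" for a b :: nat
    by auto
  show ?thesis
    using False by (auto simp: ext_gen_def ext_mult_basis ext_sign_def fun_eq_iff *)
qed (simp add: ext_gen_square)

text \<open>
  \<open>ideal I E\<close> includes \<open>ring E\<close>, so \<open>Idl\<close> would degenerate to \<open>UNIV\<close> without the next lemma.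
\<close>

lemma ext_alg_ring: "ring (ext_alg n :: (nat set \<Rightarrow> 'a::comm_ring_1) ring)"
proof (rule ringI)
  show "abelian_group (ext_alg n :: (nat set \<Rightarrow> 'a) ring)"
  proof (rule abelian_groupI)
    fix x :: "nat set \<Rightarrow> 'a" assume "x \<in> carrier (ext_alg n)"
    then show "\<exists>y\<in>carrier (ext_alg n). y \<oplus>\<^bsub>ext_alg n\<^esub> x = \<zero>\<^bsub>ext_alg n\<^esub>"
      by (intro bexI[of _ "\<lambda>S. - x S"]) (auto simp: ext_alg_def)
  qed (auto simp: ext_alg_def add_ac)
  show "monoid (ext_alg n :: (nat set \<Rightarrow> 'a) ring)"
  proof (rule monoidI)
    fix x y :: "nat set \<Rightarrow> 'a"
    assume xy: "x \<in> carrier (ext_alg n)" "y \<in> carrier (ext_alg n)"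
    have "ext_mult x y U = 0" if "\<not> U \<subseteq> {1..n}" for U
      unfolding ext_mult_def
    proof (rule sum.neutral, rule ballI)
      fix S assume "S \<in> Pow U"
      then have "\<not> S \<subseteq> {1..n} \<or> \<not> U - S \<subseteq> {1..n}" using that by blast
      then show "ext_sign S (U - S) * x S * y (U - S) = 0"
      proof
        assume "\<not> S \<subseteq> {1..n}"
        then have "x S = 0" using xy by (simp add: ext_alg_def)
        then show ?thesis by simp
      next
        assume "\<not> U - S \<subseteq> {1..n}"
        then have "y (U - S) = 0" using xy by (simp add: ext_alg_def)
        then show ?thesis by simp
      qed
    qed
    then show "x \<otimes>\<^bsub>ext_alg n\<^esub> y \<in> carrier (ext_alg n)"
      by (simp add: ext_alg_def)
  next
    fix x :: "nat set \<Rightarrow> 'a" assume x: "x \<in> carrier (ext_alg n)"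
    have inf: "x U = 0" if "infinite U" for U
      using x that finite_subset[of U "{1..n}"] by (auto simp: ext_alg_def)
    have "ext_mult (ext_scalar 1) x U = x U" "ext_mult x (ext_scalar 1) U = x U" for U
      by (cases "finite U";
          simp add: ext_mult_infinite inf ext_mult_scalar_left ext_mult_scalar_right)+
    then show "\<one>\<^bsub>ext_alg n\<^esub> \<otimes>\<^bsub>ext_alg n\<^esub> x = x" "x \<otimes>\<^bsub>ext_alg n\<^esub> \<one>\<^bsub>ext_alg n\<^esub> = x"
      by (auto simp: ext_alg_def)
  qed (auto simp: ext_alg_def ext_mult_assoc ext_scalar_def)
qed (auto simp: ext_alg_def ext_mult_def fun_eq_iff algebra_simps sum.distrib)

lemma ext_wedge_sorted:
  assumes "sorted_wrt (<) xs"
  shows "ext_wedge n xs = (ext_basis (set xs) :: nat set \<Rightarrow> 'a::comm_ring_1)"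
  using assms
proof (induction xs)
  case Nil
  then show ?case by (simp add: ext_wedge_def ext_alg_def ext_basis_def ext_scalar_def)
next
  case (Cons x xs)
  have "ext_wedge n (x # xs) = (ext_mult (ext_gen x) (ext_wedge n xs) :: nat set \<Rightarrow> 'a)"
    by (simp add: ext_wedge_def ext_alg_def)
  also have "\<dots> = ext_mult (ext_basis {x}) (ext_basis (set xs))"
    using Cons by (simp add: ext_gen_def)
  also have "\<dots> = (\<lambda>U. if U = insert x (set xs) then ext_sign {x} (set xs) else 0)"
    using Cons.prems by (auto simp: ext_mult_basis)
  also have "{(s, t). s \<in> {x} \<and> t \<in> set xs \<and> t < s} = {}"
    using Cons.prems by auto
  then have "ext_sign {x} (set xs) = (1 :: 'a)"
    unfolding ext_sign_def by (simp only: card.empty power_0)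
  finally show ?case by (simp add: ext_basis_def)
qed

text \<open>From here on \<open>M\<close> is the set of circuits of a matroid on \<open>{1..n}\<close>.\<close>

definition os_ideal :: "nat \<Rightarrow> nat set set \<Rightarrow> (nat set \<Rightarrow> 'a::comm_ring_1) set" where
  "os_ideal n M = Idl\<^bsub>ext_alg n\<^esub> (ext_boundary n ` M)"

definition os_algebra :: "nat \<Rightarrow> nat set set \<Rightarrow> (nat set \<Rightarrow> 'a::comm_ring_1) set ring" where
  "os_algebra n M = ext_alg n Quot os_ideal n M"

definition os_class :: "nat \<Rightarrow> nat set set \<Rightarrow> (nat set \<Rightarrow> 'a::comm_ring_1) \<Rightarrow> (nat set \<Rightarrow> 'a) set" where
  "os_class n M x = os_ideal n M +>\<^bsub>ext_alg n\<^esub> x"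

definition os_gen :: "nat \<Rightarrow> nat set set \<Rightarrow> nat \<Rightarrow> (nat set \<Rightarrow> 'a::comm_ring_1) set" where
  "os_gen n M i = os_class n M (ext_gen i)"

text \<open>The \<open>R\<close>-module structure comes from the structure map \<open>r \<mapsto> r \<cdot> 1\<close>.\<close>

definition os_smult ::
  "nat \<Rightarrow> nat set set \<Rightarrow> 'a::comm_ring_1 \<Rightarrow> (nat set \<Rightarrow> 'a) set \<Rightarrow> (nat set \<Rightarrow> 'a) set" where
  "os_smult n M r x = os_class n M (ext_scalar r) \<otimes>\<^bsub>os_algebra n M\<^esub> x"

definition os_linear :: "nat \<Rightarrow> nat set set \<Rightarrow> (nat \<Rightarrow> 'a::comm_ring_1) \<Rightarrow> (nat set \<Rightarrow> 'a) set" where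
  "os_linear n M \<xi> = (\<Oplus>\<^bsub>os_algebra n M\<^esub>i\<in>{1..n}. os_smult n M (\<xi> i) (os_gen n M i))"

definition coord_vecs :: "nat \<Rightarrow> (nat \<Rightarrow> 'a::comm_ring_1) set" where
  "coord_vecs n = {1..n} \<rightarrow>\<^sub>E UNIV"

definition parallel :: "nat \<Rightarrow> (nat \<Rightarrow> 'a::comm_ring_1) \<Rightarrow> (nat \<Rightarrow> 'a) \<Rightarrow> bool" where
  "parallel n \<xi> \<eta> \<longleftrightarrow> (\<forall>i\<in>{1..n}. \<forall>j\<in>{1..n}. \<xi> i * \<eta> j - \<xi> j * \<eta> i = 0)"

definition resonant :: "nat \<Rightarrow> nat set set \<Rightarrow> (nat \<Rightarrow> 'a::comm_ring_1) \<Rightarrow> bool" where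
  "resonant n M \<xi> \<longleftrightarrow>
     (\<exists>\<eta>\<in>coord_vecs n. \<not> parallel n \<xi> \<eta> \<and>
        os_linear n M \<xi> \<otimes>\<^bsub>os_algebra n M\<^esub> os_linear n M \<eta> = \<zero>\<^bsub>os_algebra n M\<^esub>)"

definition resonance_variety :: "nat \<Rightarrow> nat set set \<Rightarrow> (nat \<Rightarrow> 'a::comm_ring_1) set" where
  "resonance_variety n M = {\<xi> \<in> coord_vecs n. resonant n M \<xi>}"

definition annihilator :: "'a::comm_ring_1 \<Rightarrow> 'a set" where
  "annihilator s = {r. r * s = 0}"

definition vec_annihilator :: "nat \<Rightarrow> (nat \<Rightarrow> 'a::comm_ring_1) \<Rightarrow> 'a set" where
  "vec_annihilator n \<xi> = {r. \<forall>i\<in>{1..n}. r * \<xi> i = 0}"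

text \<open>With this convention \<open>0\<close> is a zero divisor.\<close>

definition is_zero_divisor :: "'a::comm_ring_1 \<Rightarrow> bool" where
  "is_zero_divisor s \<longleftrightarrow> annihilator s \<noteq> {0}"

end

theory Submission
  imports Defs "HOL-Algebra.UnivPoly"
begin

text \<open>
  In rank two every triple \<open>{i, j, k}\<close> is a circuit, and up to sign its relation reads
  \<open>a\<^sub>i \<and> a\<^sub>j + a\<^sub>j \<and> a\<^sub>k + a\<^sub>k \<and> a\<^sub>i = 0\<close>.  Choose \<open>r\<close> with \<open>r \<lambda>\<^sub>[\<^sub>n\<^sub>] = 0\<close> and \<open>r \<lambda>\<^sub>i \<noteq> 0\<close> for some \<open>i\<close>,
  pick \<open>j \<noteq> k\<close> different from \<open>i\<close>, and let \<open>\<eta>\<close> be \<open>r\<close> at \<open>j\<close>, \<open>-r\<close> at \<open>k\<close> and zero elsewhere.  The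
  \<open>(i, j)\<close> minor of \<open>\<lambda>, \<eta>\<close> is \<open>r \<lambda>\<^sub>i \<noteq> 0\<close>, and the relations turn
  \<open>a\<^sub>\<lambda> \<and> a\<^sub>\<eta> = \<Sum>\<^sub>m r \<lambda>\<^sub>m (a\<^sub>m \<and> a\<^sub>j - a\<^sub>m \<and> a\<^sub>k)\<close> into \<open>- r \<lambda>\<^sub>[\<^sub>n\<^sub>] a\<^sub>j \<and> a\<^sub>k = 0\<close>.
\<close>

section \<open>Codimension and the circuits of a rank-two arrangement\<close>

lemma codim_antimono: "U \<subseteq> V \<Longrightarrow> codim V \<le> codim U"
  unfolding codim_def by (simp add: vec.dim_subset diff_le_mono2)

text \<open>Otherwise \<open>U \<inter> V\<close> would have at least the dimension of
  \<open>U\<close> and of \<open>V\<close>; as a subspace of both it would equal both.\<close>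

lemma codim_inter_hyperplanes:
  assumes U: "linear_hyperplane U" and V: "linear_hyperplane V" and ne: "U \<noteq> V"
  shows "codim (U \<inter> V) \<ge> 2"
proof (rule ccontr)
  assume "\<not> ?thesis"
  then have "vec.dim U \<le> vec.dim (U \<inter> V)" "vec.dim V \<le> vec.dim (U \<inter> V)"
    using U V by (auto simp: linear_hyperplane_def codim_def)
  then have "U \<inter> V = U" "U \<inter> V = V"
    using U V by (intro vec.subspace_dim_equal vec.subspace_inter; simp add: linear_hyperplane_def)+
  then show False
    using ne by blast
qed

text \<open>The triple is dependent because its intersection contains that of all hyperplanes, so
  its codimension is at most 2 < 3. It is minimal because a set of size 0, 1 or 2 has codimension at
  least its size; for pairs this uses that distinct indices give distinct hyperplanes.\<close>

lemma arr_matroid_triple: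
  assumes arr: "hyperplane_arrangement n H" and rank: "arr_rank n H \<le> 2"
    and ijk: "i \<in> {1..n}" "j \<in> {1..n}" "k \<in> {1..n}" "distinct [i, j, k]"
  shows "{i, j, k} \<in> arr_matroid n H"
proof -
  have "codim (\<Inter>m\<in>{i, j, k}. H m) \<le> arr_rank n H"
    unfolding arr_rank_def using ijk by (intro codim_antimono INF_superset_mono) auto
  then have "dependent_set H {i, j, k}"
    using rank ijk by (simp add: dependent_set_def)
  moreover have hyp: "linear_hyperplane (H m)" if "m \<in> {i, j, k}" for m
    using arr ijk that by (auto simp: hyperplane_arrangement_def)
  have inj: "inj_on H {i, j, k}"
    using arr ijk inj_on_subset[of H "{1..n}" "{i, j, k}"] by (simp add: hyperplane_arrangement_def)
  have "\<not> dependent_set H D" if "D \<subset> {i, j, k}" for D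
  proof -
    have "card D < 3"
      using that ijk psubset_card_mono[OF _ that] by simp
    then consider "card D = 0" | "card D = 1" | "card D = 2"
      by linarith
    then show ?thesis
    proof cases
      case 2
      then obtain a where "D = {a}"
        by (auto simp: card_1_singleton_iff)
      then show ?thesis
        using hyp[of a] that by (auto simp: dependent_set_def linear_hyperplane_def)
    next
      case 3
      then obtain a b where ab: "D = {a, b}" "a \<noteq> b"
        by (auto simp: card_2_iff)
      moreover have "a \<in> {i, j, k}" "b \<in> {i, j, k}"
        using that ab by auto
      ultimately have "codim (H a \<inter> H b) \<ge> 2"
        using inj by (intro codim_inter_hyperplanes hyp) (simp_all only: inj_on_eq_iff not_False_eq_True)
      then show ?thesis
        using ab by (simp add: dependent_set_def)
    qed (simp add: dependent_set_def)
  qed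
  ultimately show ?thesis
    using ijk by (auto simp: arr_matroid_def)
qed

section \<open>Computations in the exterior algebra\<close>

lemma ext_mult_sum_left:
  "ext_mult (\<lambda>U. \<Sum>i\<in>A. c i * f i U) g = (\<lambda>U. \<Sum>i\<in>A. c i * ext_mult (f i) g U)"
  unfolding ext_mult_def
  by (rule ext) (simp add: sum_distrib_left sum_distrib_right mult_ac sum.swap[of _ A])

text \<open>Linearity in the shape needed for a right factor \<open>r * (e_j - e_k)\<close>.\<close>

lemma ext_mult_scaled_diff_right:
  "ext_mult f (\<lambda>U. r * (g U - h U)) = (\<lambda>U. r * (ext_mult f g U - ext_mult f h U))"
  unfolding ext_mult_def
  by (rule ext) (simp add: sum_distrib_left sum_subtractf algebra_simps)

lemma ext_gen_carrier: "i \<in> {1..n} \<Longrightarrow> ext_gen i \<in> carrier (ext_alg n)"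
  by (auto simp: ext_alg_def ext_gen_def ext_basis_def)

lemma ext_scalar_carrier: "ext_scalar r \<in> carrier (ext_alg n)"
  by (auto simp: ext_alg_def ext_scalar_def)

lemma ext_alg_scalar_mult:
  assumes "x \<in> carrier (ext_alg n)"
  shows "ext_scalar r \<otimes>\<^bsub>ext_alg n\<^esub> x = (\<lambda>U. r * x U)"
proof
  fix U
  show "(ext_scalar r \<otimes>\<^bsub>ext_alg n\<^esub> x) U = r * x U"
  proof (cases "finite U")
    case False
    \<comment> \<open>On infinite \<open>U\<close> the product is 0 by the default value of infinite
      sums; the right side agrees because elements of the carrier vanish outside subsets of
      \<open>{1..n}\<close>.\<close>
    then have "\<not> U \<subseteq> {1..n}"
      using finite_subset by blast
    then show ?thesis
      using False assms by (simp add: ext_alg_def ext_mult_infinite)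
  qed (simp add: ext_alg_def ext_mult_scalar_left)
qed

lemma ext_alg_finsum:
  fixes f :: "'i \<Rightarrow> nat set \<Rightarrow> 'a::comm_ring_1"
  assumes "finite A" "f \<in> A \<rightarrow> carrier (ext_alg n)"
  shows "(\<Oplus>\<^bsub>ext_alg n\<^esub>i\<in>A. f i) = (\<lambda>U. \<Sum>i\<in>A. f i U)"
proof -
  interpret ring "ext_alg n :: (nat set \<Rightarrow> 'a::comm_ring_1) ring"
    by (rule ext_alg_ring)
  show ?thesis
    using assms
  proof (induction A rule: finite_induct)
    case empty
    have "finsum (ext_alg n) f {} = \<zero>\<^bsub>ext_alg n\<^esub>"
      by (rule finsum_empty)
    then show ?case
      by (simp only: sum.empty) (simp add: ext_alg_def)
  next
    case (insert a A)
    then have "finsum (ext_alg n) f (insert a A) = f a \<oplus>\<^bsub>ext_alg n\<^esub> finsum (ext_alg n) f A"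
      by (intro finsum_insert) auto
    also have "\<dots> = (\<lambda>U. f a U + (\<Sum>i\<in>A. f i U))"
      using insert by (simp add: ext_alg_def)
    finally show ?case
      using insert by simp
  qed
qed

lemma ext_wedge_carrier:
  assumes "set xs \<subseteq> {1..n}"
  shows "(ext_wedge n xs :: nat set \<Rightarrow> 'a::comm_ring_1) \<in> carrier (ext_alg n)"
proof -
  interpret ring "ext_alg n :: (nat set \<Rightarrow> 'a::comm_ring_1) ring"
    by (rule ext_alg_ring)
  show ?thesis
    using assms by (induction xs) (auto simp: ext_wedge_def ext_gen_carrier)
qed

lemma ext_boundary_term_carrier:
  assumes "set xs \<subseteq> {1..n}"
  shows "ext_scalar (r :: 'a::comm_ring_1) \<otimes>\<^bsub>ext_alg n\<^esub> ext_wedge n (take k xs @ drop (Suc k) xs)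
    \<in> carrier (ext_alg n)"
proof -
  interpret ring "ext_alg n :: (nat set \<Rightarrow> 'a::comm_ring_1) ring"
    by (rule ext_alg_ring)
  have "set (take k xs @ drop (Suc k) xs) \<subseteq> {1..n}"
    using assms set_take_subset[of k xs] set_drop_subset[of "Suc k" xs] by auto
  then show ?thesis
    by (intro m_closed ext_scalar_carrier ext_wedge_carrier)
qed

lemma ext_boundary_carrier:
  assumes "C \<subseteq> {1..n}"
  shows "(ext_boundary n C :: nat set \<Rightarrow> 'a::comm_ring_1) \<in> carrier (ext_alg n)"
proof -
  interpret ring "ext_alg n :: (nat set \<Rightarrow> 'a::comm_ring_1) ring"
    by (rule ext_alg_ring)
  have "set (sorted_list_of_set C) \<subseteq> {1..n}"
    using assms finite_subset[OF assms] by simp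
  then show ?thesis
    unfolding ext_boundary_def Let_def
    by (intro finsum_closed Pi_I ext_boundary_term_carrier)
qed

text \<open>For i < j < k this is the boundary e_j e_k - e_i e_k + e_i e_j, with the middle term
  rewritten as e_k e_i. The cyclic form equals (e_i - e_k)(e_j - e_k) and is alternating, so it
  makes sense for indices in any order, even repeated ones.\<close>

definition ext_triangle :: "nat \<Rightarrow> nat \<Rightarrow> nat \<Rightarrow> nat set \<Rightarrow> 'a::comm_ring_1" where
  "ext_triangle i j k U =
     ext_mult (ext_gen i) (ext_gen j) U + ext_mult (ext_gen j) (ext_gen k) U
       + ext_mult (ext_gen k) (ext_gen i) U"

lemma ext_triangle_rotate: "ext_triangle i j k = ext_triangle j k i"
  by (simp add: ext_triangle_def fun_eq_iff algebra_simps)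

text \<open>The sign is kept as a scalar factor -1 so that closure of the ideal under scalars
  applies directly.\<close>

lemma ext_triangle_swap: "ext_triangle j i k = (\<lambda>U. - 1 * ext_triangle i j k U)"
  by (simp add: ext_triangle_def fun_eq_iff ext_gen_anticommute[of j i] ext_gen_anticommute[of i k]
      ext_gen_anticommute[of k j])

lemma ext_triangle_degenerate: "ext_triangle i i k = (\<lambda>_. 0)"
  by (simp add: ext_triangle_def fun_eq_iff ext_gen_square ext_gen_anticommute[of i k])

lemma ext_boundary_triple:
  assumes "a < b" "b < c" "{a, b, c} \<subseteq> {1..n}"
  shows "ext_boundary n {a, b, c} = (ext_triangle a b c :: nat set \<Rightarrow> 'a::comm_ring_1)"
proof -
  interpret ring "ext_alg n :: (nat set \<Rightarrow> 'a::comm_ring_1) ring"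
    by (rule ext_alg_ring)
  have xs: "sorted_list_of_set {a, b, c} = [a, b, c]"
    using assms sorted_list_of_set.idem_if_sorted_distinct[of "[a, b, c]"] by simp
  \<comment> \<open>The fold in \<open>ext_wedge\<close> ends in the unit, which has to be
    absorbed.\<close>
  have wedge: "ext_wedge n [x, y] = (ext_mult (ext_gen x) (ext_gen y) :: nat set \<Rightarrow> 'a)"
    if "{x, y} \<subseteq> {1..n}" for x y
  proof -
    have "ext_wedge n [x, y] = (ext_gen x :: nat set \<Rightarrow> 'a) \<otimes>\<^bsub>ext_alg n\<^esub> (ext_gen y \<otimes>\<^bsub>ext_alg n\<^esub> \<one>\<^bsub>ext_alg n\<^esub>)"
      by (simp add: ext_wedge_def)
    also have "\<dots> = ext_gen x \<otimes>\<^bsub>ext_alg n\<^esub> ext_gen y"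
      using that by (subst r_one) (auto intro: ext_gen_carrier)
    finally show ?thesis
      by (simp add: ext_alg_def)
  qed
  have "ext_boundary n {a, b, c} = (\<lambda>U. \<Sum>k<3.
      (ext_scalar ((- 1 :: 'a) ^ k) \<otimes>\<^bsub>ext_alg n\<^esub>
        ext_wedge n (take k [a, b, c] @ drop (Suc k) [a, b, c])) U)"
    unfolding ext_boundary_def xs Let_def using assms(3)
    by (subst ext_alg_finsum) (simp_all add: ext_boundary_term_carrier numeral_3_eq_3 del: drop_Suc_Cons)
  also have "\<dots> = (\<lambda>U. \<Sum>k<3. (- 1) ^ k * ext_wedge n (take k [a, b, c] @ drop (Suc k) [a, b, c]) U)"
  proof -
    have "set (take k [a, b, c] @ drop (Suc k) [a, b, c]) \<subseteq> {1..n}" for k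
      using assms(3) set_take_subset[of k "[a, b, c]"] set_drop_subset[of "Suc k" "[a, b, c]"] by auto
    then show ?thesis
      by (simp only: ext_alg_scalar_mult ext_wedge_carrier)
  qed
  \<comment> \<open>Omitting positions 0, 1, 2 gives e_b e_c, - e_a e_c, e_a e_b; anticommutation
    turns the middle term into e_c e_a.\<close>
  also have "\<dots> = ext_triangle a b c"
    using assms(3)
    by (simp add: fun_eq_iff ext_triangle_def numeral_3_eq_3 wedge ext_gen_anticommute[of c a])
  finally show ?thesis .
qed

section \<open>The Orlik-Solomon ideal and its triangle elements\<close>

lemma os_ideal_ideal:
  assumes "M \<subseteq> Pow {1..n}"
  shows "ideal (os_ideal n M) (ext_alg n)"
  unfolding os_ideal_def using assms
  by (intro ring.genideal_ideal ext_alg_ring) (blast intro!: ext_boundary_carrier)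

lemma ext_boundary_in_os_ideal:
  assumes "M \<subseteq> Pow {1..n}" "C \<in> M"
  shows "ext_boundary n C \<in> os_ideal n M"
proof -
  have "ext_boundary n ` M \<subseteq> carrier (ext_alg n)"
    using assms by (blast intro!: ext_boundary_carrier)
  from ring.genideal_self[OF ext_alg_ring this] show ?thesis
    using assms by (auto simp: os_ideal_def)
qed

text \<open>Scaling by \<open>r\<close> is multiplication by the ring element
  \<open>ext_scalar r\<close>, which an ideal absorbs.\<close>

lemma os_ideal_smult:
  fixes x :: "nat set \<Rightarrow> 'a::comm_ring_1"
  assumes M: "M \<subseteq> Pow {1..n}" and x: "x \<in> os_ideal n M"
  shows "(\<lambda>U. r * x U) \<in> os_ideal n M"
proof -
  interpret ideal "os_ideal n M :: (nat set \<Rightarrow> 'a) set" "ext_alg n"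
    by (rule os_ideal_ideal[OF M])
  have "ext_scalar r \<otimes>\<^bsub>ext_alg n\<^esub> x \<in> os_ideal n M"
    by (intro I_l_closed x ext_scalar_carrier)
  moreover have "x \<in> carrier (ext_alg n)"
    using x by (rule a_Hcarr)
  ultimately show ?thesis
    by (simp add: ext_alg_scalar_mult)
qed

lemma os_ideal_zero:
  assumes "M \<subseteq> Pow {1..n}"
  shows "(\<lambda>_. 0) \<in> os_ideal n M"
  using additive_subgroup.zero_closed[OF ideal.axioms(1)[OF os_ideal_ideal[OF assms]]]
  by (simp add: ext_alg_def)

lemma os_ideal_sum:
  fixes f :: "'i \<Rightarrow> nat set \<Rightarrow> 'a::comm_ring_1"
  assumes M: "M \<subseteq> Pow {1..n}" and "finite A" "\<And>i. i \<in> A \<Longrightarrow> f i \<in> os_ideal n M"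
  shows "(\<lambda>U. \<Sum>i\<in>A. f i U) \<in> os_ideal n M"
  using assms(2,3)
proof (induction A rule: finite_induct)
  case empty
  then show ?case by (simp add: os_ideal_zero[OF M])
next
  case (insert a A)
  interpret ideal "os_ideal n M :: (nat set \<Rightarrow> 'a) set" "ext_alg n"
    by (rule os_ideal_ideal[OF M])
  have "f a \<oplus>\<^bsub>ext_alg n\<^esub> (\<lambda>U. \<Sum>i\<in>A. f i U) \<in> os_ideal n M"
    using insert by (intro additive_subgroup.a_closed[OF is_additive_subgroup]) auto
  then show ?case
    using insert by (simp add: ext_alg_def)
qed

text \<open>The generator attached to a circuit is the triangle of its increasing ordering; any
  other ordering differs by a rotation, a sign, or both.\<close>

lemma ext_triangle_in_os_ideal:
  assumes M: "M \<subseteq> Pow {1..n}" "{i, j, k} \<in> M" and "distinct [i, j, k]"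
  shows "(ext_triangle i j k :: nat set \<Rightarrow> 'a::comm_ring_1) \<in> os_ideal n M"
proof -
  have sorted: "(ext_triangle a b c :: nat set \<Rightarrow> 'a) \<in> os_ideal n M"
    if "a < b" "b < c" "{a, b, c} = {i, j, k}" for a b c
  proof -
    have "(ext_boundary n {a, b, c} :: nat set \<Rightarrow> 'a) \<in> os_ideal n M"
      using M that by (intro ext_boundary_in_os_ideal) auto
    moreover have "{a, b, c} \<subseteq> {1..n}"
      using M that by auto
    ultimately show ?thesis
      by (simp only: ext_boundary_triple[OF that(1,2)])
  qed
  have swap: "(ext_triangle b a c :: nat set \<Rightarrow> 'a) \<in> os_ideal n M"
    if "(ext_triangle a b c :: nat set \<Rightarrow> 'a) \<in> os_ideal n M" for a b c
    unfolding ext_triangle_swap[of b a c] by (rule os_ideal_smult[OF M(1) that])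
  \<comment> \<open>The first three orderings are even and need at most a rotation; the last three
    are odd and also need a swap.\<close>
  consider "i < j" "j < k" | "j < k" "k < i" | "k < i" "i < j"
    | "j < i" "i < k" | "i < k" "k < j" | "k < j" "j < i"
    using assms(3) by fastforce
  then show ?thesis
  proof cases
    case 1
    then show ?thesis by (intro sorted) auto
  next
    case 2
    then show ?thesis unfolding ext_triangle_rotate[of i j k] by (intro sorted) auto
  next
    case 3
    then show ?thesis unfolding ext_triangle_rotate[of k i j, symmetric] by (intro sorted) auto
  next
    case 4
    then show ?thesis by (intro swap[OF sorted]) auto
  next
    case 5
    then show ?thesis unfolding ext_triangle_rotate[of k i j, symmetric] by (intro swap[OF sorted]) auto
  next
    case 6
    then show ?thesis unfolding ext_triangle_rotate[of i j k] by (intro swap[OF sorted]) auto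
  qed
qed

section \<open>Passage to the quotient algebra\<close>

lemma os_class_hom:
  assumes "M \<subseteq> Pow {1..n}"
  shows "ring_hom_ring (ext_alg n :: (nat set \<Rightarrow> 'a::comm_ring_1) ring) (os_algebra n M) (os_class n M)"
proof -
  have "os_class n M = (+>\<^bsub>ext_alg n\<^esub>) (os_ideal n M :: (nat set \<Rightarrow> 'a) set)"
    by (simp add: os_class_def fun_eq_iff)
  then show ?thesis
    using ideal.rcos_ring_hom_ring[OF os_ideal_ideal[OF assms]] by (simp add: os_algebra_def)
qed

lemma ext_linear_carrier:
  "(\<lambda>U. \<Sum>i\<in>{1..n}. \<xi> i * ext_gen i U) \<in> carrier (ext_alg n)"
  by (auto simp: ext_alg_def ext_gen_def ext_basis_def intro!: sum.neutral)

text \<open>The module structure on the quotient is multiplication by classes of scalars, so the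
  projection, being a ring homomorphism, carries the linear form upstairs to a_\<xi>.\<close>

lemma os_linear_eq_class:
  fixes \<xi> :: "nat \<Rightarrow> 'a::comm_ring_1"
  assumes M: "M \<subseteq> Pow {1..n}"
  shows "os_linear n M \<xi> = os_class n M (\<lambda>U. \<Sum>i\<in>{1..n}. \<xi> i * ext_gen i U)"
proof -
  interpret ring_hom_ring "ext_alg n :: (nat set \<Rightarrow> 'a) ring" "os_algebra n M" "os_class n M"
    by (rule os_class_hom[OF M])
  let ?f = "\<lambda>i. ext_scalar (\<xi> i) \<otimes>\<^bsub>ext_alg n\<^esub> ext_gen i"
  have f: "?f \<in> {1..n} \<rightarrow> carrier (ext_alg n)"
    by (intro Pi_I R.m_closed ext_scalar_carrier ext_gen_carrier)
  have "os_linear n M \<xi> = (\<Oplus>\<^bsub>os_algebra n M\<^esub>i\<in>{1..n}. (os_class n M \<circ> ?f) i)"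
    unfolding os_linear_def
  proof (rule S.finsum_cong')
    show "os_class n M \<circ> ?f \<in> {1..n} \<rightarrow> carrier (os_algebra n M)"
      using f by (auto intro!: hom_closed)
    show "os_smult n M (\<xi> i) (os_gen n M i) = (os_class n M \<circ> ?f) i" if "i \<in> {1..n}" for i
      using that by (simp add: os_smult_def os_gen_def ext_scalar_carrier ext_gen_carrier)
  qed simp
  also have "\<dots> = os_class n M (\<Oplus>\<^bsub>ext_alg n\<^esub>i\<in>{1..n}. ?f i)"
    using hom_finsum[OF f] by (simp add: comp_def)
  also have "(\<Oplus>\<^bsub>ext_alg n\<^esub>i\<in>{1..n}. ?f i) = (\<lambda>U. \<Sum>i\<in>{1..n}. \<xi> i * ext_gen i U)"
    by (subst ext_alg_finsum[OF _ f]) (simp_all add: fun_eq_iff ext_alg_scalar_mult ext_gen_carrier)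
  finally show ?thesis .
qed

lemma os_linear_mult_eq_zero:
  fixes \<xi> \<eta> :: "nat \<Rightarrow> 'a::comm_ring_1"
  assumes M: "M \<subseteq> Pow {1..n}"
    and "ext_mult (\<lambda>U. \<Sum>i\<in>{1..n}. \<xi> i * ext_gen i U) (\<lambda>U. \<Sum>i\<in>{1..n}. \<eta> i * ext_gen i U)
      \<in> os_ideal n M"
  shows "os_linear n M \<xi> \<otimes>\<^bsub>os_algebra n M\<^esub> os_linear n M \<eta> = \<zero>\<^bsub>os_algebra n M\<^esub>"
proof -
  interpret I: ideal "os_ideal n M :: (nat set \<Rightarrow> 'a) set" "ext_alg n"
    by (rule os_ideal_ideal[OF M])
  interpret ring_hom_ring "ext_alg n :: (nat set \<Rightarrow> 'a) ring" "os_algebra n M" "os_class n M"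
    by (rule os_class_hom[OF M])
  let ?x = "\<lambda>U. \<Sum>i\<in>{1..n}. \<xi> i * ext_gen i U" and ?y = "\<lambda>U. \<Sum>i\<in>{1..n}. \<eta> i * ext_gen i U"
  have "os_linear n M \<xi> \<otimes>\<^bsub>os_algebra n M\<^esub> os_linear n M \<eta> = os_class n M (?x \<otimes>\<^bsub>ext_alg n\<^esub> ?y)"
    by (simp only: os_linear_eq_class[OF M] hom_mult[OF ext_linear_carrier ext_linear_carrier])
  \<comment> \<open>The zero of the quotient is the ideal itself as a coset, and adding a member
    leaves the ideal unchanged.\<close>
  also have "\<dots> = os_ideal n M"
    using assms(2) by (simp add: os_class_def I.a_rcos_const ext_alg_def[of n, THEN arg_cong[of _ _ mult]])
  finally show ?thesis
    by (simp add: os_algebra_def FactRing_def)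
qed

section \<open>Construction of the non-parallel partner \<open>eta\<close>\<close>

theorem theorem3p4:
  fixes n :: nat and H :: "nat \<Rightarrow> (complex ^ 'l) set" and lam :: "nat \<Rightarrow> 'a::comm_ring_1"
  assumes "hyperplane_arrangement n H"
    and "arr_rank n H = 2"
    and "n \<ge> 3"
    and "lam \<in> coord_vecs n"
    and "is_zero_divisor (\<Sum>i\<in>{1..n}. lam i)"
    and "annihilator (\<Sum>i\<in>{1..n}. lam i) \<noteq> vec_annihilator n lam"
  shows "lam \<in> resonance_variety n (arr_matroid n H)"
proof -
  let ?M = "arr_matroid n H"
  have M: "?M \<subseteq> Pow {1..n}"
    by (auto simp: arr_matroid_def)
  \<comment> \<open>This inclusion always holds, so the assumed inequality forces the existence of
    an \<open>r\<close> killing the sum but not \<open>lam\<close>.\<close>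
  have "vec_annihilator n lam \<subseteq> annihilator (\<Sum>i\<in>{1..n}. lam i)"
    by (auto simp: vec_annihilator_def annihilator_def sum_distrib_left)
  then obtain r where "r \<in> annihilator (\<Sum>i\<in>{1..n}. lam i)" "r \<notin> vec_annihilator n lam"
    using assms(6) by blast
  then obtain i where r: "r * (\<Sum>i\<in>{1..n}. lam i) = 0" and i: "i \<in> {1..n}" "r * lam i \<noteq> 0"
    by (auto simp: vec_annihilator_def annihilator_def)
  \<comment> \<open>Here \<open>n \<ge> 3\<close> supplies two further indices besides
    \<open>i\<close>.\<close>
  have "card ({1..n} - {i}) \<ge> 2"
    using i assms(3) by simp
  then obtain B where "B \<subseteq> {1..n} - {i}" "card B = 2"
    by (rule obtain_subset_with_card_n)
  then obtain j k where jk: "j \<in> {1..n}" "k \<in> {1..n}" "distinct [i, j, k]"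
    by (auto simp: card_2_iff)
  \<comment> \<open>The restriction to \<open>{1..n}\<close> makes \<open>eta\<close> extensional,
    as \<open>coord_vecs\<close> demands.\<close>
  define eta where "eta = (\<lambda>m\<in>{1..n}. if m = j then r else if m = k then - r else 0)"
  have "lam i * eta j - lam j * eta i = r * lam i"
    using i jk by (simp add: eta_def mult.commute)
  then have not_parallel: "\<not> parallel n lam eta"
    using i jk unfolding parallel_def by metis
  have eta: "(\<lambda>U. \<Sum>m\<in>{1..n}. eta m * ext_gen m U) = (\<lambda>U. r * (ext_gen j U - ext_gen k U))"
  proof
    fix U
    have "(\<Sum>m\<in>{1..n}. eta m * ext_gen m U) =
        (\<Sum>m\<in>{1..n}. (if m = j then r * ext_gen j U else 0) + (if m = k then - r * ext_gen k U else 0))"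
      using jk by (intro sum.cong) (auto simp: eta_def)
    also have "\<dots> = r * (ext_gen j U - ext_gen k U)"
      using jk by (simp add: sum.distrib algebra_simps)
    finally show "(\<Sum>m\<in>{1..n}. eta m * ext_gen m U) = r * (ext_gen j U - ext_gen k U)" .
  qed
  have triangle: "ext_triangle m j k \<in> os_ideal n ?M" if "m \<in> {1..n}" for m
  proof -
    \<comment> \<open>With a repeated index the triangle is 0, so \<open>m\<close> may run over all
      of \<open>{1..n}\<close>.\<close>
    consider "m = j" | "m = k" | "distinct [m, j, k]"
      using jk by auto
    then show ?thesis
    proof cases
      case 1
      then show ?thesis by (simp add: ext_triangle_degenerate os_ideal_zero[OF M])
    next
      case 2
      then show ?thesis
        by (simp add: ext_triangle_rotate[of k k j, symmetric] ext_triangle_degenerate os_ideal_zero[OF M])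
    next
      case 3
      then show ?thesis
        using assms(1,2) that jk
        by (intro ext_triangle_in_os_ideal[OF M] arr_matroid_triple) auto
    qed
  qed
  \<comment> \<open>This is an identity in the exterior algebra itself: the two sides differ by
    \<open>r\<close> times the sum of \<open>lam\<close> times e_j e_k, which is 0 by the choice of
    \<open>r\<close>.\<close>
  have "ext_mult (\<lambda>U. \<Sum>m\<in>{1..n}. lam m * ext_gen m U) (\<lambda>U. \<Sum>m\<in>{1..n}. eta m * ext_gen m U) =
      (\<lambda>U. \<Sum>m\<in>{1..n}. (lam m * r) * ext_triangle m j k U)"
  proof
    fix U
    let ?e = "\<lambda>a b. ext_mult (ext_gen a) (ext_gen b) U"
    have "(\<Sum>m\<in>{1..n}. (lam m * r) * ext_triangle m j k U) =
        (\<Sum>m\<in>{1..n}. lam m * (r * (?e m j - ?e m k)) + lam m * (r * ?e j k))"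
      by (intro sum.cong) (simp_all add: ext_triangle_def ext_gen_anticommute[of k] algebra_simps)
    also have "\<dots> = (\<Sum>m\<in>{1..n}. lam m * (r * (?e m j - ?e m k)))
        + (r * (\<Sum>m\<in>{1..n}. lam m)) * ?e j k"
      by (simp add: sum.distrib sum_distrib_left sum_distrib_right mult_ac)
    finally show "ext_mult (\<lambda>U. \<Sum>m\<in>{1..n}. lam m * ext_gen m U)
        (\<lambda>U. \<Sum>m\<in>{1..n}. eta m * ext_gen m U) U =
      (\<Sum>m\<in>{1..n}. (lam m * r) * ext_triangle m j k U)"
      by (simp only: r eta ext_mult_sum_left ext_mult_scaled_diff_right mult_zero_left add_0_right)
  qed
  moreover have "(\<lambda>U. \<Sum>m\<in>{1..n}. (lam m * r) * ext_triangle m j k U) \<in> os_ideal n ?M"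
    by (intro os_ideal_sum[OF M] os_ideal_smult[OF M] triangle) auto
  ultimately have "os_linear n ?M lam \<otimes>\<^bsub>os_algebra n ?M\<^esub> os_linear n ?M eta = \<zero>\<^bsub>os_algebra n ?M\<^esub>"
    by (intro os_linear_mult_eq_zero[OF M]) simp
  moreover have "eta \<in> coord_vecs n"
    by (simp add: coord_vecs_def eta_def)
  ultimately show ?thesis
    using not_parallel assms(4) by (auto simp: resonance_variety_def resonant_def)
qed

end
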